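(* Let $\mathcal{C}$ be a category with pullbacks and a terminal object, let $\tau$ be a Grothendieck topology on $\mathcal{C}$, and let $G$ be a group object of $\mathcal{C}$. Let $\pi_P\colon P\to Y$ be a principal $G$-bundle over an object $Y$ of $\mathcal{C}$ and let $f\colon Z\to Y$ be a morphism of $\mathcal{C}$. Then the pullback $P\times_Y Z$ of $\pi_P$ along $f$, equipped with the pullback action of $G$ (with $Y$ and $Z$ carrying trivial actions), is a principal $G$-bundle over $Z$ with morphism $\pi_{P\times_Y Z}:=f^*\pi_P\colon P\times_Y Z\to Z$.
   Context: For $f\colon P\to Y$ and $g\colon Z\to Y$, write $f^*g\colon P\times_Y Z\to P$ and $g^*f\colon P\times_Y Z\to Z$ for the projections of the pullback. **Actions.** Let $G$ be a group object with multiplication $m\colon G\times G\to G$ and unit $e\colon T\to G$, with $T$ terminal. An action of $G$ on $X$ is a morphism $x\colon G\times X\to X$ with $x\circ(\mathrm{id}_G\times x)=x\circ(m\times \mathrm{id}_X)$ and $x\circ(e\times \mathrm{id}_X)=\mathrm{pr}_2\colon T\times X\to X$. If $G$ acts on $X$ and $Y$ by $x,y$, a morphism $f\colon X\to Y$ is $G$-equivariant if $f\circ x=y\circ(\mathrm{id}_G\times f)$. Objects for which no action is specified carry the trivial action (second projection). If $G$ acts on $P,Y,Z$ via $p,y,z$ and $f\colon P\to Y$, $g\colon Z\to Y$ are $G$-equivariant, the pullback action on $P\times_Y Z$ is the action $\psi\colon G\times(P\times_Y Z)\to P\times_Y Z$ determined by $f^*g\circ\psi=p\circ(\mathrm{id}_G\times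 f^*g)$ and $g^*f\circ\psi=z\circ(\mathrm{id}_G\times g^*f)$. **Principal bundles.** A principal $G$-bundle over $Y$ (in the site $(\mathcal{C},\tau)$) is a $G$-equivariant locally trivial morphism $\pi_P\colon P\to Y$, where the object $P$ is equipped with an action $p\colon G\times P\to P$ ($Y$ carries the trivial action). Here $\pi_P$ is locally trivial if there exists a covering $\{f_i\colon U_i\to Y\}_{i\in I}$ of $Y$ for $\tau$ such that for every $i\in I$ the pullback $P\times_Y U_i$ of $\pi_P$ along $f_i$ is isomorphic to $G\times U_i$ via a $G$-equivariant isomorphism $\phi_i\colon P\times_Y U_i\to G\times U_i$, where $P\times_Y U_i$ has the pullback action above ($U_i$, $Y$ with trivial actions) and $G\times U_i$ has the action $\theta_i\colon G\times(G\times U_i)\to G\times U_i$ given by the canonical isomorphism $G\times(G\times U_i)\cong(G\times G)\times U_i$ followed by $m\times\mathrm{id}_{U_i}$.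
   Formalization: In "locally trivial", each G-equivariant isomorphism φ_i from P×_Y U_i to G×U_i is also required to commute with the projections to U_i, in hypothesis and conclusion alike; without this the claim is false (Set, trivial G, a non-surjective map ℕ→ℕ pulled back to a point with empty fibre). *)

theory Defs
  imports Main
begin

section \<open>Categories with chosen pullbacks and a chosen terminal object\<close>

text \<open>
  Objects and morphisms are carrier sets. Composition is written in applicative order: \<open>g \<cdot> f\<close>
  means \<open>f\<close> first. \<open>Pb1 C f g\<close> and \<open>Pb2 C f g\<close> are the projections
  \<open>f\<^sup>*g : P \<times>\<^sub>Y Z \<rightarrow> P\<close> and \<open>g\<^sup>*f : P \<times>\<^sub>Y Z \<rightarrow> Z\<close> of the pullback of
  \<open>f : P \<rightarrow> Y\<close> and \<open>g : Z \<rightarrow> Y\<close>. The choice of pullbacks and of the terminal object is an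
  arbitrary part of the structure.
\<close>

record ('o, 'm) pb_category =
  Obj :: "'o set"
  Arr :: "'m set"
  Dom :: "'m \<Rightarrow> 'o"
  Cod :: "'m \<Rightarrow> 'o"
  Id  :: "'o \<Rightarrow> 'm"
  Cmp :: "'m \<Rightarrow> 'm \<Rightarrow> 'm" (infixr "\<cdot>\<index>" 70)
  Trm :: "'o"
  Pb1 :: "'m \<Rightarrow> 'm \<Rightarrow> 'm"
  Pb2 :: "'m \<Rightarrow> 'm \<Rightarrow> 'm"

definition Hom :: "('o, 'm, 'z) pb_category_scheme \<Rightarrow> 'o \<Rightarrow> 'o \<Rightarrow> 'm set" where
  "Hom C A B = {f \<in> Arr C. Dom C f = A \<and> Cod C f = B}"

locale category =
  fixes C :: "('o, 'm, 'z) pb_category_scheme" (structure)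
  assumes Dom_Obj: "f \<in> Arr C \<Longrightarrow> Dom C f \<in> Obj C"
    and Cod_Obj: "f \<in> Arr C \<Longrightarrow> Cod C f \<in> Obj C"
    and Id_Hom: "A \<in> Obj C \<Longrightarrow> Id C A \<in> Hom C A A"
    and Cmp_Hom: "\<lbrakk>f \<in> Hom C A B; g \<in> Hom C B D\<rbrakk> \<Longrightarrow> g \<cdot> f \<in> Hom C A D"
    and Cmp_Id: "f \<in> Hom C A B \<Longrightarrow> f \<cdot> Id C A = f"
    and Id_Cmp: "f \<in> Hom C A B \<Longrightarrow> Id C B \<cdot> f = f"
    and Cmp_assoc: "\<lbrakk>f \<in> Hom C A B; g \<in> Hom C B D; h \<in> Hom C D E\<rbrakk>
        \<Longrightarrow> (h \<cdot> g) \<cdot> f = h \<cdot> (g \<cdot> f)"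

definition is_iso :: "('o, 'm, 'z) pb_category_scheme \<Rightarrow> 'o \<Rightarrow> 'o \<Rightarrow> 'm \<Rightarrow> bool" where
  "is_iso C A B f \<longleftrightarrow> f \<in> Hom C A B \<and>
     (\<exists>g \<in> Hom C B A. g \<cdot>\<^bsub>C\<^esub> f = Id C A \<and> f \<cdot>\<^bsub>C\<^esub> g = Id C B)"

definition is_pullback ::
  "('o, 'm, 'z) pb_category_scheme \<Rightarrow> 'm \<Rightarrow> 'm \<Rightarrow> 'm \<Rightarrow> 'm \<Rightarrow> bool" where
  "is_pullback C f g p q \<longleftrightarrow>
     f \<in> Arr C \<and> g \<in> Arr C \<and> Cod C f = Cod C g \<and>
     p \<in> Hom C (Dom C p) (Dom C f) \<and> q \<in> Hom C (Dom C p) (Dom C g) \<and>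
     f \<cdot>\<^bsub>C\<^esub> p = g \<cdot>\<^bsub>C\<^esub> q \<and>
     (\<forall>W. \<forall>a \<in> Hom C W (Dom C f). \<forall>b \<in> Hom C W (Dom C g). f \<cdot>\<^bsub>C\<^esub> a = g \<cdot>\<^bsub>C\<^esub> b \<longrightarrow>
        (\<exists>!h. h \<in> Hom C W (Dom C p) \<and> p \<cdot>\<^bsub>C\<^esub> h = a \<and> q \<cdot>\<^bsub>C\<^esub> h = b))"

locale category_with_pullbacks_and_terminal = category C
  for C :: "('o, 'm, 'z) pb_category_scheme" (structure) +
  assumes Trm_Obj: "Trm C \<in> Obj C"
    and Trm_terminal: "A \<in> Obj C \<Longrightarrow> \<exists>!t. t \<in> Hom C A (Trm C)"
    and Pb_pullback: "\<lbrakk>f \<in> Arr C; g \<in> Arr C; Cod C f = Cod C g\<rbrakk>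
        \<Longrightarrow> is_pullback C f g (Pb1 C f g) (Pb2 C f g)"

definition pb_obj :: "('o, 'm, 'z) pb_category_scheme \<Rightarrow> 'm \<Rightarrow> 'm \<Rightarrow> 'o" where
  "pb_obj C f g = Dom C (Pb1 C f g)"

definition pb_pair :: "('o, 'm, 'z) pb_category_scheme \<Rightarrow> 'm \<Rightarrow> 'm \<Rightarrow> 'm \<Rightarrow> 'm \<Rightarrow> 'm" where
  "pb_pair C f g a b = (THE h. h \<in> Hom C (Dom C a) (pb_obj C f g) \<and>
     Pb1 C f g \<cdot>\<^bsub>C\<^esub> h = a \<and> Pb2 C f g \<cdot>\<^bsub>C\<^esub> h = b)"


section \<open>Binary products, as pullbacks over the terminal object\<close>

definition to_trm :: "('o, 'm, 'z) pb_category_scheme \<Rightarrow> 'o \<Rightarrow> 'm" where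
  "to_trm C A = (THE t. t \<in> Hom C A (Trm C))"

definition Prod :: "('o, 'm, 'z) pb_category_scheme \<Rightarrow> 'o \<Rightarrow> 'o \<Rightarrow> 'o" where
  "Prod C A B = pb_obj C (to_trm C A) (to_trm C B)"

definition pr1 :: "('o, 'm, 'z) pb_category_scheme \<Rightarrow> 'o \<Rightarrow> 'o \<Rightarrow> 'm" where
  "pr1 C A B = Pb1 C (to_trm C A) (to_trm C B)"

definition pr2 :: "('o, 'm, 'z) pb_category_scheme \<Rightarrow> 'o \<Rightarrow> 'o \<Rightarrow> 'm" where
  "pr2 C A B = Pb2 C (to_trm C A) (to_trm C B)"

definition pair :: "('o, 'm, 'z) pb_category_scheme \<Rightarrow> 'm \<Rightarrow> 'm \<Rightarrow> 'm" where
  "pair C a b = pb_pair C (to_trm C (Cod C a)) (to_trm C (Cod C b)) a b"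

definition prod_map :: "('o, 'm, 'z) pb_category_scheme \<Rightarrow> 'm \<Rightarrow> 'm \<Rightarrow> 'm" where
  "prod_map C f g =
     pair C (f \<cdot>\<^bsub>C\<^esub> pr1 C (Dom C f) (Dom C g)) (g \<cdot>\<^bsub>C\<^esub> pr2 C (Dom C f) (Dom C g))"

text \<open>The canonical isomorphism \<open>A \<times> (B \<times> D) \<rightarrow> (A \<times> B) \<times> D\<close>.\<close>

definition assoc :: "('o, 'm, 'z) pb_category_scheme \<Rightarrow> 'o \<Rightarrow> 'o \<Rightarrow> 'o \<Rightarrow> 'm" where
  "assoc C A B D =
     pair C
       (pair C (pr1 C A (Prod C B D)) (pr1 C B D \<cdot>\<^bsub>C\<^esub> pr2 C A (Prod C B D)))
       (pr2 C B D \<cdot>\<^bsub>C\<^esub> pr2 C A (Prod C B D))"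


section \<open>Grothendieck topologies\<close>

text \<open>
  A topology is given by its covering families. A family \<open>{f\<^sub>i : U\<^sub>i \<rightarrow> Y}\<close> is represented by
  its set of members, so \<open>R \<in> Cov Y\<close> says that the set \<open>R\<close> of morphisms into \<open>Y\<close> is a covering
  of \<open>Y\<close>. Stability under base change is required for every choice of pullback squares.
\<close>

locale grothendieck_topology = category_with_pullbacks_and_terminal C
  for C :: "('o, 'm, 'z) pb_category_scheme" (structure) +
  fixes Cov :: "'o \<Rightarrow> 'm set set"
  assumes Cov_arrows: "\<lbrakk>Y \<in> Obj C; R \<in> Cov Y; u \<in> R\<rbrakk> \<Longrightarrow> u \<in> Arr C \<and> Cod C u = Y"
    and Cov_iso: "is_iso C X Y u \<Longrightarrow> {u} \<in> Cov Y"
    and Cov_base_change: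
      "\<lbrakk>h \<in> Hom C Z Y; R \<in> Cov Y; \<And>u. u \<in> R \<Longrightarrow> is_pullback C u h (p u) (q u)\<rbrakk>
        \<Longrightarrow> q ` R \<in> Cov Z"
    and Cov_composition:
      "\<lbrakk>Y \<in> Obj C; R \<in> Cov Y; \<And>u. u \<in> R \<Longrightarrow> S u \<in> Cov (Dom C u)\<rbrakk>
        \<Longrightarrow> {u \<cdot> v | u v. u \<in> R \<and> v \<in> S u} \<in> Cov Y"


section \<open>Group objects and actions\<close>

definition group_object :: "('o, 'm, 'z) pb_category_scheme \<Rightarrow> 'o \<Rightarrow> 'm \<Rightarrow> 'm \<Rightarrow> bool" where
  "group_object C G m e \<longleftrightarrow>
     G \<in> Obj C \<and> m \<in> Hom C (Prod C G G) G \<and> e \<in> Hom C (Trm C) G \<and>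
     m \<cdot>\<^bsub>C\<^esub> prod_map C (Id C G) m = m \<cdot>\<^bsub>C\<^esub> prod_map C m (Id C G) \<cdot>\<^bsub>C\<^esub> assoc C G G G \<and>
     m \<cdot>\<^bsub>C\<^esub> prod_map C e (Id C G) = pr2 C (Trm C) G \<and>
     m \<cdot>\<^bsub>C\<^esub> prod_map C (Id C G) e = pr1 C G (Trm C) \<and>
     (\<exists>i \<in> Hom C G G.
        m \<cdot>\<^bsub>C\<^esub> pair C i (Id C G) = e \<cdot>\<^bsub>C\<^esub> to_trm C G \<and>
        m \<cdot>\<^bsub>C\<^esub> pair C (Id C G) i = e \<cdot>\<^bsub>C\<^esub> to_trm C G)"

definition is_action ::
  "('o, 'm, 'z) pb_category_scheme \<Rightarrow> 'o \<Rightarrow> 'm \<Rightarrow> 'm \<Rightarrow> 'o \<Rightarrow> 'm \<Rightarrow> bool" where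
  "is_action C G m e X x \<longleftrightarrow>
     X \<in> Obj C \<and> x \<in> Hom C (Prod C G X) X \<and>
     x \<cdot>\<^bsub>C\<^esub> prod_map C (Id C G) x = x \<cdot>\<^bsub>C\<^esub> prod_map C m (Id C X) \<cdot>\<^bsub>C\<^esub> assoc C G G X \<and>
     x \<cdot>\<^bsub>C\<^esub> prod_map C e (Id C X) = pr2 C (Trm C) X"

definition trivial_action :: "('o, 'm, 'z) pb_category_scheme \<Rightarrow> 'o \<Rightarrow> 'o \<Rightarrow> 'm" where
  "trivial_action C G X = pr2 C G X"

definition equivariant ::
  "('o, 'm, 'z) pb_category_scheme \<Rightarrow> 'o \<Rightarrow> 'o \<Rightarrow> 'm \<Rightarrow> 'o \<Rightarrow> 'm \<Rightarrow> 'm \<Rightarrow> bool" where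
  "equivariant C G X x Y y f \<longleftrightarrow>
     f \<in> Hom C X Y \<and> f \<cdot>\<^bsub>C\<^esub> x = y \<cdot>\<^bsub>C\<^esub> prod_map C (Id C G) f"

text \<open>
  By definition of \<open>pb_pair\<close>, this is the unique \<open>\<psi>\<close> with
  \<open>f\<^sup>*g \<cdot> \<psi> = p \<cdot> (id \<times> f\<^sup>*g)\<close> and \<open>g\<^sup>*f \<cdot> \<psi> = z \<cdot> (id \<times> g\<^sup>*f)\<close>.
\<close>

definition pullback_action ::
  "('o, 'm, 'z) pb_category_scheme \<Rightarrow> 'o \<Rightarrow> 'm \<Rightarrow> 'm \<Rightarrow> 'm \<Rightarrow> 'm \<Rightarrow> 'm" where
  "pullback_action C G f g p z =
     pb_pair C f g
       (p \<cdot>\<^bsub>C\<^esub> prod_map C (Id C G) (Pb1 C f g))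
       (z \<cdot>\<^bsub>C\<^esub> prod_map C (Id C G) (Pb2 C f g))"

text \<open>The action \<open>\<theta>\<close> of \<open>G\<close> on \<open>G \<times> U\<close> by multiplication on the first factor.\<close>

definition left_mult_action ::
  "('o, 'm, 'z) pb_category_scheme \<Rightarrow> 'o \<Rightarrow> 'm \<Rightarrow> 'o \<Rightarrow> 'm" where
  "left_mult_action C G m U = prod_map C m (Id C U) \<cdot>\<^bsub>C\<^esub> assoc C G G U"


section \<open>Principal bundles\<close>

text \<open>
  The trivialisation \<open>\<phi>\<close> is an isomorphism over \<open>U = Dom u\<close> (last conjunct), i.e. it
  identifies the pulled back morphism \<open>u\<^sup>*\<pi>\<close> with the projection \<open>G \<times> U \<rightarrow> U\<close>. If only
  the total spaces were compared, local triviality would not be stable under base change: for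
  trivial \<open>G\<close> in the category of sets, every map between countably infinite sets would be
  locally trivial, including those with empty fibres.
\<close>

definition locally_trivial ::
  "('o, 'm, 'z) pb_category_scheme \<Rightarrow> ('o \<Rightarrow> 'm set set) \<Rightarrow> 'o \<Rightarrow> 'm \<Rightarrow> 'o \<Rightarrow> 'm \<Rightarrow> 'm \<Rightarrow> bool" where
  "locally_trivial C Cov G m Y p \<pi> \<longleftrightarrow>
     (\<exists>R \<in> Cov Y. \<forall>u \<in> R. \<exists>\<phi>.
        is_iso C (pb_obj C \<pi> u) (Prod C G (Dom C u)) \<phi> \<and>
        equivariant C G
          (pb_obj C \<pi> u) (pullback_action C G \<pi> u p (trivial_action C G (Dom C u)))
          (Prod C G (Dom C u)) (left_mult_action C G m (Dom C u)) \<phi> \<and>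
        pr2 C G (Dom C u) \<cdot>\<^bsub>C\<^esub> \<phi> = Pb2 C \<pi> u)"

definition principal_bundle ::
  "('o, 'm, 'z) pb_category_scheme \<Rightarrow> ('o \<Rightarrow> 'm set set) \<Rightarrow> 'o \<Rightarrow> 'm \<Rightarrow> 'm \<Rightarrow>
     'o \<Rightarrow> 'o \<Rightarrow> 'm \<Rightarrow> 'm \<Rightarrow> bool" where
  "principal_bundle C Cov G m e Y P p \<pi> \<longleftrightarrow>
     Y \<in> Obj C \<and> is_action C G m e P p \<and>
     equivariant C G P p Y (trivial_action C G Y) \<pi> \<and>
     locally_trivial C Cov G m Y p \<pi>"

end

theory Submission
  imports Defs
begin

text \<open>
  Write \<open>Q = P \<times>\<^sub>Y Z\<close>. Morphisms into \<open>Q\<close> are determined by their components in \<open>P\<close> and \<open>Z\<close>, and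
  the pullback action is computed componentwise, so the action laws for \<open>Q\<close> are those of \<open>P\<close> and of
  the trivial action on \<open>Z\<close> (lemma \<open>pullback_action_is_action\<close>), and \<open>Q \<rightarrow> Z\<close> is equivariant because
  it is one of the two components.

  For local triviality, let \<open>R\<close> be a covering of \<open>Y\<close> that trivialises \<open>\<pi>\<close>. Its base change along \<open>f\<close>,
  with members \<open>v : U \<times>\<^sub>Y Z \<rightarrow> Z\<close>, covers \<open>Z\<close>, and it trivialises \<open>Q\<close>: with \<open>V = U \<times>\<^sub>Y Z\<close>, pasting of
  pullback squares and the trivialisation \<open>P \<times>\<^sub>Y U \<cong> G \<times> U\<close> give
  \<open>Q \<times>\<^sub>Z V \<cong> P \<times>\<^sub>Y V \<cong> (P \<times>\<^sub>Y U) \<times>\<^sub>U V \<cong> (G \<times> U) \<times>\<^sub>U V \<cong> G \<times> V\<close>.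
  The third isomorphism exists because the given trivialisation is one over \<open>U\<close>. The composite
  is written out, together with its inverse, in lemma \<open>trivialisation_base_change\<close>.

  Action laws and equivariance are used in terms of generalised elements: a morphism
  out of \<open>G \<times> X\<close> is known once its composites with all pairs \<open>(a, c)\<close> of morphisms into \<open>G\<close> and
  \<open>X\<close> are. Thus an action \<open>x\<close> satisfies \<open>x (a, x (b, c)) = x (m (a, b), c)\<close>, as in the category of sets.
\<close>


section \<open>Calculus of pullbacks and products\<close>

lemma Hom_iff: "f \<in> Hom C A B \<longleftrightarrow> f \<in> Arr C \<and> Dom C f = A \<and> Cod C f = B"
  by (simp add: Hom_def)

text \<open>
  The axioms are restated with \<open>Arr\<close>, \<open>Dom\<close> and \<open>Cod\<close> in place of \<open>Hom\<close>, because a hypothesis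
  \<open>g \<in> Hom C B D\<close> of a rewrite rule would leave the simplifier to guess \<open>B\<close>. In this form composites
  are typed by rewriting.
\<close>

context category
begin

lemma Dom_Obj' [simp]: "f \<in> Arr C \<Longrightarrow> Dom C f \<in> Obj C"
  and Cod_Obj' [simp]: "f \<in> Arr C \<Longrightarrow> Cod C f \<in> Obj C"
  by (rule Dom_Obj, assumption) (rule Cod_Obj)

lemma Id_simps [simp]:
  assumes "A \<in> Obj C"
  shows "Id C A \<in> Arr C" "Dom C (Id C A) = A" "Cod C (Id C A) = A"
  using Id_Hom[OF assms] by (simp_all add: Hom_iff)

lemma Cmp_simps [simp]:
  assumes "f \<in> Arr C" "g \<in> Arr C" "Cod C f = Dom C g"
  shows "g \<cdot> f \<in> Arr C" "Dom C (g \<cdot> f) = Dom C f" "Cod C (g \<cdot> f) = Cod C g"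
  using Cmp_Hom[of f "Dom C f" "Dom C g" g "Cod C g"] assms by (simp_all add: Hom_iff)

lemma Cmp_Id_simps [simp]:
  assumes "f \<in> Arr C"
  shows "Dom C f = A \<Longrightarrow> f \<cdot> Id C A = f" "Cod C f = B \<Longrightarrow> Id C B \<cdot> f = f"
  using Cmp_Id[of f "Dom C f" "Cod C f"] Id_Cmp[of f "Dom C f" "Cod C f"] assms
  by (auto simp: Hom_iff)

lemma Cmp_assoc_simp [simp]:
  assumes "f \<in> Arr C" "g \<in> Arr C" "h \<in> Arr C" "Cod C f = Dom C g" "Cod C g = Dom C h"
  shows "(h \<cdot> g) \<cdot> f = h \<cdot> (g \<cdot> f)"
  using Cmp_assoc[of f "Dom C f" "Dom C g" g "Dom C h" h "Cod C h"] assms by (simp add: Hom_iff)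

end

context category_with_pullbacks_and_terminal
begin

lemma Pb_simps [simp]:
  assumes "f \<in> Arr C" "g \<in> Arr C" "Cod C f = Cod C g"
  shows "Pb1 C f g \<in> Arr C" "Dom C (Pb1 C f g) = pb_obj C f g" "Cod C (Pb1 C f g) = Dom C f"
    "Pb2 C f g \<in> Arr C" "Dom C (Pb2 C f g) = pb_obj C f g" "Cod C (Pb2 C f g) = Dom C g"
  using Pb_pullback[OF assms] by (simp_all add: is_pullback_def Hom_iff pb_obj_def)

lemma pb_obj_Obj [simp]:
  "f \<in> Arr C \<Longrightarrow> g \<in> Arr C \<Longrightarrow> Cod C f = Cod C g \<Longrightarrow> pb_obj C f g \<in> Obj C"
  by (metis Pb_simps(1,2) Dom_Obj)

lemma Pb_commute:
  "f \<in> Arr C \<Longrightarrow> g \<in> Arr C \<Longrightarrow> Cod C f = Cod C g \<Longrightarrow> f \<cdot> Pb1 C f g = g \<cdot> Pb2 C f g"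
  using Pb_pullback[of f g] by (simp add: is_pullback_def)

lemma Pb_commute_Cmp:
  assumes "f \<in> Arr C" "g \<in> Arr C" "Cod C f = Cod C g" "h \<in> Arr C" "Cod C h = pb_obj C f g"
  shows "f \<cdot> (Pb1 C f g \<cdot> h) = g \<cdot> (Pb2 C f g \<cdot> h)"
  using arg_cong[OF Pb_commute[OF assms(1-3)], of "\<lambda>k. k \<cdot> h"] assms by simp

lemma Pb_universal:
  assumes "f \<in> Arr C" "g \<in> Arr C" "Cod C f = Cod C g"
    and "a \<in> Arr C" "b \<in> Arr C" "Dom C a = Dom C b" "Cod C a = Dom C f" "Cod C b = Dom C g"
    and "f \<cdot> a = g \<cdot> b"
  shows "\<exists>!h. h \<in> Hom C (Dom C a) (pb_obj C f g) \<and> Pb1 C f g \<cdot> h = a \<and> Pb2 C f g \<cdot> h = b"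
proof -
  have "a \<in> Hom C (Dom C a) (Dom C f)" "b \<in> Hom C (Dom C a) (Dom C g)"
    using assms by (simp_all add: Hom_iff)
  then show ?thesis
    using Pb_pullback[OF assms(1-3)] \<open>f \<cdot> a = g \<cdot> b\<close> unfolding is_pullback_def pb_obj_def by blast
qed

lemma pb_pair_simps [simp]:
  assumes "f \<in> Arr C" "g \<in> Arr C" "Cod C f = Cod C g"
    and "a \<in> Arr C" "b \<in> Arr C" "Dom C a = Dom C b" "Cod C a = Dom C f" "Cod C b = Dom C g"
    and "f \<cdot> a = g \<cdot> b"
  shows "pb_pair C f g a b \<in> Arr C" "Dom C (pb_pair C f g a b) = Dom C a"
    "Cod C (pb_pair C f g a b) = pb_obj C f g"
    "Pb1 C f g \<cdot> pb_pair C f g a b = a" "Pb2 C f g \<cdot> pb_pair C f g a b = b"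
  using theI'[OF Pb_universal[OF assms]] by (simp_all add: pb_pair_def Hom_iff)

lemma Pb_pb_pair_Cmp [simp]:
  assumes "f \<in> Arr C" "g \<in> Arr C" "Cod C f = Cod C g"
    and "a \<in> Arr C" "b \<in> Arr C" "Dom C a = Dom C b" "Cod C a = Dom C f" "Cod C b = Dom C g"
    and "f \<cdot> a = g \<cdot> b" "h \<in> Arr C" "Cod C h = Dom C a"
  shows "Pb1 C f g \<cdot> (pb_pair C f g a b \<cdot> h) = a \<cdot> h"
    "Pb2 C f g \<cdot> (pb_pair C f g a b \<cdot> h) = b \<cdot> h"
  using assms by (simp_all flip: Cmp_assoc_simp)

lemma Pb_jointly_monic:
  assumes "f \<in> Arr C" "g \<in> Arr C" "Cod C f = Cod C g"
    and "h \<in> Hom C W (pb_obj C f g)" "k \<in> Hom C W (pb_obj C f g)"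
    and "Pb1 C f g \<cdot> h = Pb1 C f g \<cdot> k" "Pb2 C f g \<cdot> h = Pb2 C f g \<cdot> k"
  shows "h = k"
proof -
  have "\<exists>!l. l \<in> Hom C (Dom C (Pb1 C f g \<cdot> k)) (pb_obj C f g) \<and>
      Pb1 C f g \<cdot> l = Pb1 C f g \<cdot> k \<and> Pb2 C f g \<cdot> l = Pb2 C f g \<cdot> k"
    using assms by (intro Pb_universal) (simp_all add: Hom_iff Pb_commute_Cmp)
  moreover have "Dom C (Pb1 C f g \<cdot> k) = W"
    using assms by (simp add: Hom_iff)
  ultimately show ?thesis
    using assms(4-7) by auto
qed

lemma Trm_Obj' [simp]: "Trm C \<in> Obj C"
  by (rule Trm_Obj)

lemma to_trm_simps [simp]:
  assumes "A \<in> Obj C"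
  shows "to_trm C A \<in> Arr C" "Dom C (to_trm C A) = A" "Cod C (to_trm C A) = Trm C"
  using theI'[OF Trm_terminal[OF assms]] by (simp_all add: to_trm_def Hom_iff)

lemma to_trm_unique:
  assumes "f \<in> Arr C" "Dom C f = A" "Cod C f = Trm C"
  shows "f = to_trm C A"
  using Trm_terminal[of A] assms by (metis Dom_Obj Hom_iff to_trm_simps)

lemma Prod_simps [simp]:
  assumes "A \<in> Obj C" "B \<in> Obj C"
  shows "Prod C A B \<in> Obj C"
    "pr1 C A B \<in> Arr C" "Dom C (pr1 C A B) = Prod C A B" "Cod C (pr1 C A B) = A"
    "pr2 C A B \<in> Arr C" "Dom C (pr2 C A B) = Prod C A B" "Cod C (pr2 C A B) = B"
  using assms by (simp_all add: Prod_def pr1_def pr2_def)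

lemma pair_simps [simp]:
  assumes "a \<in> Arr C" "b \<in> Arr C" "Dom C a = Dom C b"
  shows "pair C a b \<in> Arr C" "Dom C (pair C a b) = Dom C a"
    "Cod C (pair C a b) = Prod C (Cod C a) (Cod C b)"
    "Cod C a = A \<Longrightarrow> Cod C b = B \<Longrightarrow> pr1 C A B \<cdot> pair C a b = a"
    "Cod C a = A \<Longrightarrow> Cod C b = B \<Longrightarrow> pr2 C A B \<cdot> pair C a b = b"
proof -
  have trm: "to_trm C (Cod C a) \<cdot> a = to_trm C (Cod C b) \<cdot> b"
    by (rule trans[OF to_trm_unique[of _ "Dom C a"] to_trm_unique[of _ "Dom C a", symmetric]])
    (use assms in simp_all)
  note simps = pb_pair_simps[of "to_trm C (Cod C a)" "to_trm C (Cod C b)" a b]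
  show "pair C a b \<in> Arr C" "Dom C (pair C a b) = Dom C a"
    "Cod C (pair C a b) = Prod C (Cod C a) (Cod C b)"
    using simps(1-3) assms trm by (simp_all add: pair_def Prod_def)
  show "pr1 C A B \<cdot> pair C a b = a" if "Cod C a = A" "Cod C b = B"
    using simps(4) assms trm unfolding that[symmetric] by (simp add: pair_def pr1_def)
  show "pr2 C A B \<cdot> pair C a b = b" if "Cod C a = A" "Cod C b = B"
    using simps(5) assms trm unfolding that[symmetric] by (simp add: pair_def pr2_def)
qed

lemma pr_jointly_monic:
  assumes "A \<in> Obj C" "B \<in> Obj C" "h \<in> Hom C W (Prod C A B)" "k \<in> Hom C W (Prod C A B)"
    and "pr1 C A B \<cdot> h = pr1 C A B \<cdot> k" "pr2 C A B \<cdot> h = pr2 C A B \<cdot> k"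
  shows "h = k"
  using assms Pb_jointly_monic[of "to_trm C A" "to_trm C B" h W k]
  by (simp add: Prod_def pr1_def pr2_def)

lemma pair_Cmp [simp]:
  assumes "a \<in> Arr C" "b \<in> Arr C" "Dom C a = Dom C b" "h \<in> Arr C" "Cod C h = Dom C a"
  shows "pair C a b \<cdot> h = pair C (a \<cdot> h) (b \<cdot> h)"
  by (rule pr_jointly_monic[of "Cod C a" "Cod C b" _ "Dom C h"])
    (use assms in \<open>simp_all add: Hom_iff flip: Cmp_assoc_simp\<close>)

lemma pair_pr [simp]:
  assumes "h \<in> Arr C" "Cod C h = Prod C A B" "A \<in> Obj C" "B \<in> Obj C"
  shows "pair C (pr1 C A B \<cdot> h) (pr2 C A B \<cdot> h) = h"
  by (rule pr_jointly_monic[of A B _ "Dom C h"])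
    (use assms in \<open>simp_all add: Hom_iff\<close>)

lemma pair_pr_Id [simp]:
  "A \<in> Obj C \<Longrightarrow> B \<in> Obj C \<Longrightarrow> pair C (pr1 C A B) (pr2 C A B) = Id C (Prod C A B)"
  using pair_pr[of "Id C (Prod C A B)" A B] by simp

lemma prod_map_simps [simp]:
  assumes "f \<in> Arr C" "g \<in> Arr C"
  shows "prod_map C f g \<in> Arr C" "Dom C (prod_map C f g) = Prod C (Dom C f) (Dom C g)"
    "Cod C (prod_map C f g) = Prod C (Cod C f) (Cod C g)"
  using assms by (simp_all add: prod_map_def)

lemma prod_map_pair [simp]:
  assumes "f \<in> Arr C" "g \<in> Arr C" "a \<in> Arr C" "b \<in> Arr C" "Dom C a = Dom C b"
    "Cod C a = Dom C f" "Cod C b = Dom C g"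
  shows "prod_map C f g \<cdot> pair C a b = pair C (f \<cdot> a) (g \<cdot> b)"
  using assms by (simp add: prod_map_def)

lemma assoc_simps [simp]:
  assumes "A \<in> Obj C" "B \<in> Obj C" "D \<in> Obj C"
  shows "assoc C A B D \<in> Arr C" "Dom C (assoc C A B D) = Prod C A (Prod C B D)"
    "Cod C (assoc C A B D) = Prod C (Prod C A B) D"
  using assms by (simp_all add: assoc_def)

lemma assoc_pair [simp]:
  assumes "a \<in> Arr C" "b \<in> Arr C" "c \<in> Arr C" "Dom C a = Dom C b" "Dom C b = Dom C c"
    "Cod C a = A" "Cod C b = B" "Cod C c = D"
  shows "assoc C A B D \<cdot> pair C a (pair C b c) = pair C (pair C a b) c"
  using assms by (auto simp: assoc_def)

text \<open>
  A morphism out of a product can be read off from the generic element, the pair of the two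
  projections, whose composite with it is the morphism itself. This is the Yoneda principle that
  turns identities between actions into identities between their values on elements.
\<close>

lemma Prod_ext:
  assumes "A \<in> Obj C" "B \<in> Obj C" "h \<in> Hom C (Prod C A B) X" "k \<in> Hom C (Prod C A B) X"
    and eq: "\<And>a b. \<lbrakk>a \<in> Arr C; b \<in> Arr C; Dom C a = Dom C b; Cod C a = A; Cod C b = B\<rbrakk>
        \<Longrightarrow> h \<cdot> pair C a b = k \<cdot> pair C a b"
  shows "h = k"
  using eq[of "pr1 C A B" "pr2 C A B"] assms by (simp add: Hom_iff)


section \<open>Actions in terms of generalised elements\<close>

text \<open>
  Composing the diagrams that define an action with an arbitrary pair of elements gives the element
  laws, and conversely \<open>Prod_ext\<close> recovers the diagrams. Every morphism into the terminal
  object is the canonical one, hence the unit appears as \<open>e \<cdot> to_trm C (Dom C c)\<close>.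
\<close>

lemma is_action_iff_elements:
  assumes G: "G \<in> Obj C" and m: "m \<in> Hom C (Prod C G G) G" and e: "e \<in> Hom C (Trm C) G"
    and X: "X \<in> Obj C" and x: "x \<in> Hom C (Prod C G X) X"
  shows "is_action C G m e X x \<longleftrightarrow>
    (\<forall>a b c. a \<in> Arr C \<longrightarrow> b \<in> Arr C \<longrightarrow> c \<in> Arr C \<longrightarrow> Dom C a = Dom C b \<longrightarrow> Dom C b = Dom C c \<longrightarrow>
       Cod C a = G \<longrightarrow> Cod C b = G \<longrightarrow> Cod C c = X \<longrightarrow>
       x \<cdot> pair C a (x \<cdot> pair C b c) = x \<cdot> pair C (m \<cdot> pair C a b) c) \<and>
    (\<forall>c. c \<in> Arr C \<longrightarrow> Cod C c = X \<longrightarrow> x \<cdot> pair C (e \<cdot> to_trm C (Dom C c)) c = c)"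
    (is "_ \<longleftrightarrow> ?assoc \<and> ?unit")
proof
  assume act: "is_action C G m e X x"
  show "?assoc \<and> ?unit"
  proof (intro conjI allI impI)
    fix a b c
    assume abc: "a \<in> Arr C" "b \<in> Arr C" "c \<in> Arr C" "Dom C a = Dom C b" "Dom C b = Dom C c"
      "Cod C a = G" "Cod C b = G" "Cod C c = X"
    have "(x \<cdot> prod_map C (Id C G) x) \<cdot> pair C a (pair C b c) =
        (x \<cdot> prod_map C m (Id C X) \<cdot> assoc C G G X) \<cdot> pair C a (pair C b c)"
      using act by (simp add: is_action_def)
    then show "x \<cdot> pair C a (x \<cdot> pair C b c) = x \<cdot> pair C (m \<cdot> pair C a b) c"
      using G m X x abc by (simp add: Hom_iff)
  next
    fix c assume c: "c \<in> Arr C" "Cod C c = X"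
    have "(x \<cdot> prod_map C e (Id C X)) \<cdot> pair C (to_trm C (Dom C c)) c =
        pr2 C (Trm C) X \<cdot> pair C (to_trm C (Dom C c)) c"
      using act by (simp add: is_action_def)
    then show "x \<cdot> pair C (e \<cdot> to_trm C (Dom C c)) c = c"
      using G e X x c by (simp add: Hom_iff)
  qed
next
  assume elements: "?assoc \<and> ?unit"
  have "x \<cdot> prod_map C (Id C G) x = x \<cdot> prod_map C m (Id C X) \<cdot> assoc C G G X"
  proof (rule Prod_ext[of G "Prod C G X" _ X])
    fix a d
    assume ad: "a \<in> Arr C" "d \<in> Arr C" "Dom C a = Dom C d" "Cod C a = G" "Cod C d = Prod C G X"
    define b where "b = pr1 C G X \<cdot> d"
    define c where "c = pr2 C G X \<cdot> d"
    have bc: "d = pair C b c" "b \<in> Arr C" "c \<in> Arr C" "Dom C b = Dom C a" "Dom C c = Dom C a"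
        "Cod C b = G" "Cod C c = X"
      using ad G X by (simp_all add: b_def c_def)
    have "x \<cdot> pair C a (x \<cdot> pair C b c) = x \<cdot> pair C (m \<cdot> pair C a b) c"
      by (rule conjunct1[OF elements, rule_format]) (use ad(1,4) bc(2-) in simp_all)
    then show "(x \<cdot> prod_map C (Id C G) x) \<cdot> pair C a d =
        (x \<cdot> prod_map C m (Id C X) \<cdot> assoc C G G X) \<cdot> pair C a d"
      using G m X x ad(1,4) bc(2-) unfolding bc(1) by (simp add: Hom_iff)
  qed (use G m X x in \<open>simp_all add: Hom_iff\<close>)
  moreover have "x \<cdot> prod_map C e (Id C X) = pr2 C (Trm C) X"
  proof (rule Prod_ext[of "Trm C" X _ X])
    fix t c
    assume tc: "t \<in> Arr C" "c \<in> Arr C" "Dom C t = Dom C c" "Cod C t = Trm C" "Cod C c = X"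
    have "t = to_trm C (Dom C c)"
      using tc by (intro to_trm_unique)
    then have "x \<cdot> pair C (e \<cdot> t) c = c"
      using conjunct2[OF elements, rule_format, of c] tc by simp
    then show "(x \<cdot> prod_map C e (Id C X)) \<cdot> pair C t c = pr2 C (Trm C) X \<cdot> pair C t c"
      using G e X x tc by (simp add: Hom_iff)
  qed (use G e X x in \<open>simp_all add: Hom_iff\<close>)
  ultimately show "is_action C G m e X x"
    using X x by (simp add: is_action_def)
qed

lemma equivariant_iff_elements:
  assumes G: "G \<in> Obj C" and X: "X \<in> Obj C" and Y: "Y \<in> Obj C"
    and x: "x \<in> Hom C (Prod C G X) X" and y: "y \<in> Hom C (Prod C G Y) Y"
  shows "equivariant C G X x Y y f \<longleftrightarrow> f \<in> Hom C X Y \<and>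
    (\<forall>a c. a \<in> Arr C \<longrightarrow> c \<in> Arr C \<longrightarrow> Dom C a = Dom C c \<longrightarrow> Cod C a = G \<longrightarrow> Cod C c = X \<longrightarrow>
       f \<cdot> x \<cdot> pair C a c = y \<cdot> pair C a (f \<cdot> c))"
    (is "_ \<longleftrightarrow> _ \<and> ?elements")
proof
  assume eqv: "equivariant C G X x Y y f"
  then have f: "f \<in> Hom C X Y"
    by (simp add: equivariant_def)
  have ?elements
  proof (intro allI impI)
    fix a c
    assume ac: "a \<in> Arr C" "c \<in> Arr C" "Dom C a = Dom C c" "Cod C a = G" "Cod C c = X"
    have "(f \<cdot> x) \<cdot> pair C a c = (y \<cdot> prod_map C (Id C G) f) \<cdot> pair C a c"
      using eqv by (simp add: equivariant_def)
    then show "f \<cdot> x \<cdot> pair C a c = y \<cdot> pair C a (f \<cdot> c)"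
      using G X Y x y f ac by (simp add: Hom_iff)
  qed
  with f show "f \<in> Hom C X Y \<and> ?elements" ..
next
  assume fe: "f \<in> Hom C X Y \<and> ?elements"
  have "f \<cdot> x = y \<cdot> prod_map C (Id C G) f"
  proof (rule Prod_ext[of G X _ Y])
    fix a c
    assume ac: "a \<in> Arr C" "c \<in> Arr C" "Dom C a = Dom C c" "Cod C a = G" "Cod C c = X"
    then have "f \<cdot> x \<cdot> pair C a c = y \<cdot> pair C a (f \<cdot> c)"
      using fe by blast
    then show "(f \<cdot> x) \<cdot> pair C a c = (y \<cdot> prod_map C (Id C G) f) \<cdot> pair C a c"
      using G X Y x y fe ac by (simp add: Hom_iff)
  qed (use G X Y x y fe in \<open>simp_all add: Hom_iff\<close>)
  with fe show "equivariant C G X x Y y f"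
    by (simp add: equivariant_def)
qed

lemma trivial_action_simps [simp]:
  assumes "G \<in> Obj C" "X \<in> Obj C"
  shows "trivial_action C G X \<in> Arr C" "Dom C (trivial_action C G X) = Prod C G X"
    "Cod C (trivial_action C G X) = X"
    "\<lbrakk>a \<in> Arr C; c \<in> Arr C; Dom C a = Dom C c; Cod C a = G; Cod C c = X\<rbrakk>
      \<Longrightarrow> trivial_action C G X \<cdot> pair C a c = c"
  using assms by (simp_all add: trivial_action_def)

lemma trivial_action_Hom:
  "G \<in> Obj C \<Longrightarrow> X \<in> Obj C \<Longrightarrow> trivial_action C G X \<in> Hom C (Prod C G X) X"
  by (simp add: Hom_iff)

lemma trivial_action_is_action:
  assumes "G \<in> Obj C" "m \<in> Hom C (Prod C G G) G" "e \<in> Hom C (Trm C) G" "X \<in> Obj C"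
  shows "is_action C G m e X (trivial_action C G X)"
  using assms by (subst is_action_iff_elements) (simp_all add: Hom_iff)

lemma left_mult_action_Hom:
  assumes "G \<in> Obj C" "m \<in> Hom C (Prod C G G) G" "U \<in> Obj C"
  shows "left_mult_action C G m U \<in> Hom C (Prod C G (Prod C G U)) (Prod C G U)"
  using assms by (simp add: left_mult_action_def Hom_iff)

lemma left_mult_action_pair:
  assumes "G \<in> Obj C" "m \<in> Hom C (Prod C G G) G" "U \<in> Obj C"
    and "a \<in> Arr C" "d \<in> Arr C" "Dom C a = Dom C d" "Cod C a = G" "Cod C d = Prod C G U"
  shows "left_mult_action C G m U \<cdot> pair C a d =
    pair C (m \<cdot> pair C a (pr1 C G U \<cdot> d)) (pr2 C G U \<cdot> d)"
proof -
  have "left_mult_action C G m U \<cdot> pair C a (pair C (pr1 C G U \<cdot> d) (pr2 C G U \<cdot> d)) =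
      pair C (m \<cdot> pair C a (pr1 C G U \<cdot> d)) (pr2 C G U \<cdot> d)"
    using assms by (simp add: left_mult_action_def Hom_iff del: pair_pr)
  then show ?thesis
    using assms by simp
qed


section \<open>The pullback action\<close>

text \<open>
  The components prescribed for the pullback action are compatible because both legs of the cospan
  are equivariant for the same action \<open>y\<close> on the base. All that is used about the pullback action
  afterwards is its type and its two components on elements.
\<close>

lemma pullback_action_properties:
  assumes G: "G \<in> Obj C"
    and p: "p \<in> Hom C (Prod C G P) P" and y: "y \<in> Hom C (Prod C G Y) Y"
    and z: "z \<in> Hom C (Prod C G Z) Z"
    and f: "equivariant C G P p Y y f" and g: "equivariant C G Z z Y y g"
  defines "\<psi> \<equiv> pullback_action C G f g p z"
  shows pullback_action_Hom: "\<psi> \<in> Hom C (Prod C G (pb_obj C f g)) (pb_obj C f g)"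
    and pullback_action_elements:
      "\<And>a c. \<lbrakk>a \<in> Arr C; c \<in> Arr C; Dom C a = Dom C c; Cod C a = G; Cod C c = pb_obj C f g\<rbrakk>
         \<Longrightarrow> Pb1 C f g \<cdot> \<psi> \<cdot> pair C a c = p \<cdot> pair C a (Pb1 C f g \<cdot> c) \<and>
             Pb2 C f g \<cdot> \<psi> \<cdot> pair C a c = z \<cdot> pair C a (Pb2 C f g \<cdot> c)"
proof -
  have fH: "f \<in> Arr C" "Dom C f = P" "Cod C f = Y" and gH: "g \<in> Arr C" "Dom C g = Z" "Cod C g = Y"
    using f g by (simp_all add: equivariant_def Hom_iff)
  have obj: "P \<in> Obj C" "Y \<in> Obj C" "Z \<in> Obj C"
    using fH gH Dom_Obj Cod_Obj by auto
  have f_el: "f \<cdot> p \<cdot> pair C a c = y \<cdot> pair C a (f \<cdot> c)"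
    if "a \<in> Arr C" "c \<in> Arr C" "Dom C a = Dom C c" "Cod C a = G" "Cod C c = P" for a c
    using f that equivariant_iff_elements[OF G obj(1,2) p y] by blast
  have g_el: "g \<cdot> z \<cdot> pair C a c = y \<cdot> pair C a (g \<cdot> c)"
    if "a \<in> Arr C" "c \<in> Arr C" "Dom C a = Dom C c" "Cod C a = G" "Cod C c = Z" for a c
    using g that equivariant_iff_elements[OF G obj(3,2) z y] by blast
  \<comment> \<open>The two prescribed components agree over \<open>Y\<close>, so that \<open>\<psi>\<close> exists.\<close>
  have compat: "f \<cdot> (p \<cdot> prod_map C (Id C G) (Pb1 C f g)) =
      g \<cdot> (z \<cdot> prod_map C (Id C G) (Pb2 C f g))"
  proof (rule Prod_ext[of G "pb_obj C f g" _ Y])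
    fix a c
    assume ac: "a \<in> Arr C" "c \<in> Arr C" "Dom C a = Dom C c" "Cod C a = G" "Cod C c = pb_obj C f g"
    have "f \<cdot> p \<cdot> pair C a (Pb1 C f g \<cdot> c) = g \<cdot> z \<cdot> pair C a (Pb2 C f g \<cdot> c)"
      using ac fH gH by (simp add: f_el g_el Pb_commute_Cmp)
    then show "(f \<cdot> (p \<cdot> prod_map C (Id C G) (Pb1 C f g))) \<cdot> pair C a c =
        (g \<cdot> (z \<cdot> prod_map C (Id C G) (Pb2 C f g))) \<cdot> pair C a c"
      using G obj p z fH gH ac by (simp add: Hom_iff)
  qed (use G obj p z fH gH in \<open>simp_all add: Hom_iff\<close>)
  show "\<psi> \<in> Hom C (Prod C G (pb_obj C f g)) (pb_obj C f g)"
    unfolding \<psi>_def pullback_action_def using compat G obj p z fH gH by (simp add: Hom_iff)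
  fix a c
  assume ac: "a \<in> Arr C" "c \<in> Arr C" "Dom C a = Dom C c" "Cod C a = G" "Cod C c = pb_obj C f g"
  show "Pb1 C f g \<cdot> \<psi> \<cdot> pair C a c = p \<cdot> pair C a (Pb1 C f g \<cdot> c) \<and>
      Pb2 C f g \<cdot> \<psi> \<cdot> pair C a c = z \<cdot> pair C a (Pb2 C f g \<cdot> c)"
    unfolding \<psi>_def pullback_action_def using compat G obj p z fH gH ac by (simp add: Hom_iff)
qed

text \<open>
  The projections of the pullback are jointly monic and turn each law into the same law for
  \<open>p\<close> or for \<open>z\<close>.
\<close>

lemma pullback_action_is_action:
  assumes G: "G \<in> Obj C" and m: "m \<in> Hom C (Prod C G G) G" and e: "e \<in> Hom C (Trm C) G"
    and p: "is_action C G m e P p" and z: "is_action C G m e Z z"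
    and y: "y \<in> Hom C (Prod C G Y) Y"
    and f: "equivariant C G P p Y y f" and g: "equivariant C G Z z Y y g"
  shows "is_action C G m e (pb_obj C f g) (pullback_action C G f g p z)"
proof -
  have pH: "p \<in> Hom C (Prod C G P) P" and P: "P \<in> Obj C"
    and zH: "z \<in> Hom C (Prod C G Z) Z" and Z: "Z \<in> Obj C"
    using p z by (simp_all add: is_action_def)
  have fH: "f \<in> Arr C" "Dom C f = P" "Cod C f = Y" and gH: "g \<in> Arr C" "Dom C g = Z" "Cod C g = Y"
    using f g by (simp_all add: equivariant_def Hom_iff)
  define \<psi> where "\<psi> = pullback_action C G f g p z"
  note \<psi>H = pullback_action_Hom[OF G pH y zH f g, folded \<psi>_def]
  note \<psi>_el = pullback_action_elements[OF G pH y zH f g, folded \<psi>_def]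
  note p_el = iffD1[OF is_action_iff_elements[OF G m e P pH] p]
  note z_el = iffD1[OF is_action_iff_elements[OF G m e Z zH] z]
  note typing = G m e P pH Z zH fH gH \<psi>H
  have Q: "pb_obj C f g \<in> Obj C"
    using fH gH by simp
  have "is_action C G m e (pb_obj C f g) \<psi>"
    unfolding is_action_iff_elements[OF G m e Q \<psi>H]
  proof (intro conjI allI impI)
    fix a b c
    assume abc: "a \<in> Arr C" "b \<in> Arr C" "c \<in> Arr C" "Dom C a = Dom C b" "Dom C b = Dom C c"
      "Cod C a = G" "Cod C b = G" "Cod C c = pb_obj C f g"
    show "\<psi> \<cdot> pair C a (\<psi> \<cdot> pair C b c) = \<psi> \<cdot> pair C (m \<cdot> pair C a b) c"
      by (rule Pb_jointly_monic[of f g _ "Dom C c"])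
        (use typing abc in \<open>simp_all add: Hom_iff \<psi>_el p_el z_el\<close>)
  next
    fix c
    assume c: "c \<in> Arr C" "Cod C c = pb_obj C f g"
    have "e \<cdot> to_trm C (Dom C c) \<in> Arr C" "Dom C (e \<cdot> to_trm C (Dom C c)) = Dom C c"
      "Cod C (e \<cdot> to_trm C (Dom C c)) = G"
      using e c by (simp_all add: Hom_iff)
    moreover have "p \<cdot> pair C (e \<cdot> to_trm C (Dom C c)) (Pb1 C f g \<cdot> c) = Pb1 C f g \<cdot> c"
      using conjunct2[OF p_el, rule_format, of "Pb1 C f g \<cdot> c"] fH gH c by simp
    moreover have "z \<cdot> pair C (e \<cdot> to_trm C (Dom C c)) (Pb2 C f g \<cdot> c) = Pb2 C f g \<cdot> c"
      using conjunct2[OF z_el, rule_format, of "Pb2 C f g \<cdot> c"] fH gH c by simp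
    ultimately show "\<psi> \<cdot> pair C (e \<cdot> to_trm C (Dom C c)) c = c"
      using typing c
      by - (rule Pb_jointly_monic[of f g _ "Dom C c"]; simp add: Hom_iff \<psi>_el)
  qed
  then show ?thesis
    by (simp add: \<psi>_def)
qed

lemma pullback_projection_equivariant:
  assumes G: "G \<in> Obj C" and p: "p \<in> Hom C (Prod C G P) P" and y: "y \<in> Hom C (Prod C G Y) Y"
    and z: "z \<in> Hom C (Prod C G Z) Z"
    and f: "equivariant C G P p Y y f" and g: "equivariant C G Z z Y y g"
  shows "equivariant C G (pb_obj C f g) (pullback_action C G f g p z) Z z (Pb2 C f g)"
proof -
  have H: "f \<in> Arr C" "Cod C f = Y" "g \<in> Arr C" "Dom C g = Z" "Cod C g = Y"
    using f g by (simp_all add: equivariant_def Hom_iff)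
  then have obj: "pb_obj C f g \<in> Obj C" "Z \<in> Obj C"
    using Dom_Obj by auto
  show ?thesis
    unfolding equivariant_iff_elements[OF G obj pullback_action_Hom[OF assms] z]
    using H by (simp add: pullback_action_elements[OF assms] Hom_iff)
qed

lemma equivariant_trivial_action:
  assumes "G \<in> Obj C" "g \<in> Hom C Z Y"
  shows "equivariant C G Z (trivial_action C G Z) Y (trivial_action C G Y) g"
proof -
  have "Z \<in> Obj C" "Y \<in> Obj C"
    using assms(2) Dom_Obj Cod_Obj by (auto simp: Hom_iff)
  with assms show ?thesis
    by (subst equivariant_iff_elements) (simp_all add: Hom_iff)
qed


section \<open>Base change of trivialisations\<close>

definition trivialisation :: "'o \<Rightarrow> 'm \<Rightarrow> 'm \<Rightarrow> 'm \<Rightarrow> 'm \<Rightarrow> 'm \<Rightarrow> bool" where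
  "trivialisation G m p \<pi> u \<phi> \<longleftrightarrow>
     is_iso C (pb_obj C \<pi> u) (Prod C G (Dom C u)) \<phi> \<and>
     equivariant C G
       (pb_obj C \<pi> u) (pullback_action C G \<pi> u p (trivial_action C G (Dom C u)))
       (Prod C G (Dom C u)) (left_mult_action C G m (Dom C u)) \<phi> \<and>
     pr2 C G (Dom C u) \<cdot> \<phi> = Pb2 C \<pi> u"

lemma locally_trivial_iff_trivialisation:
  "locally_trivial C Cov G m Y p \<pi> \<longleftrightarrow> (\<exists>R \<in> Cov Y. \<forall>u \<in> R. \<exists>\<phi>. trivialisation G m p \<pi> u \<phi>)"
  by (simp add: locally_trivial_def trivialisation_def)

text \<open>
  A trivialisation \<open>\<phi>\<close> over \<open>u : U \<rightarrow> Y\<close> induces one of \<open>P \<times>\<^sub>Y Z \<rightarrow> Z\<close> over every \<open>v : V \<rightarrow> Z\<close> for which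
  \<open>f \<cdot> v\<close> factors through \<open>u\<close>. On elements, it sends \<open>((x, z), t)\<close> to \<open>(g, t)\<close>, where \<open>g\<close> is the
  \<open>G\<close>-component of \<open>\<phi> (x, w t)\<close>. Its inverse sends \<open>(g, t)\<close> to \<open>((x, v t), t)\<close>, where \<open>x\<close> is the
  \<open>P\<close>-component of \<open>\<phi>\<^sup>-\<^sup>1 (g, w t)\<close>.
\<close>

lemma trivialisation_base_change:
  assumes G: "G \<in> Obj C" and m: "m \<in> Hom C (Prod C G G) G"
    and p: "p \<in> Hom C (Prod C G P) P"
    and \<pi>: "equivariant C G P p Y (trivial_action C G Y) \<pi>"
    and f: "f \<in> Hom C Z Y" and u: "u \<in> Hom C U Y"
    and \<phi>: "trivialisation G m p \<pi> u \<phi>"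
    and v: "v \<in> Hom C V Z" and w: "w \<in> Hom C V U" and square: "u \<cdot> w = f \<cdot> v"
  shows "\<exists>\<Phi>. trivialisation G m (pullback_action C G \<pi> f p (trivial_action C G Z)) (Pb2 C \<pi> f) v \<Phi>"
proof -
  define \<psi> where "\<psi> = pullback_action C G \<pi> f p (trivial_action C G Z)"
  define q where "q = Pb2 C \<pi> f"
  define \<alpha> where "\<alpha> = pullback_action C G \<pi> u p (trivial_action C G U)"
  define \<beta> where "\<beta> = pullback_action C G q v \<psi> (trivial_action C G V)"
  have \<pi>H: "\<pi> \<in> Arr C" "Dom C \<pi> = P" "Cod C \<pi> = Y"
    using \<pi> by (simp_all add: equivariant_def Hom_iff)
  note fH = f[unfolded Hom_iff] and uH = u[unfolded Hom_iff]
    and vH = v[unfolded Hom_iff] and wH = w[unfolded Hom_iff]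
  have obj: "P \<in> Obj C" "Y \<in> Obj C" "Z \<in> Obj C" "U \<in> Obj C" "V \<in> Obj C"
    using \<pi>H fH uH vH Dom_Obj Cod_Obj by auto
  have qH: "q \<in> Arr C" "Dom C q = pb_obj C \<pi> f" "Cod C q = Z"
    using \<pi>H fH by (simp_all add: q_def)
  note triv_u = trivial_action_Hom[OF G obj(4)] and triv_v = trivial_action_Hom[OF G obj(5)]
    and triv_Y = trivial_action_Hom[OF G obj(2)] and triv_Z = trivial_action_Hom[OF G obj(3)]
  note eqv_u = equivariant_trivial_action[OF G u] and eqv_f = equivariant_trivial_action[OF G f]
    and eqv_v = equivariant_trivial_action[OF G v]
  note \<psi>H = pullback_action_Hom[OF G p triv_Y triv_Z \<pi> eqv_f, folded \<psi>_def]
  note \<psi>_el = pullback_action_elements[OF G p triv_Y triv_Z \<pi> eqv_f, folded \<psi>_def]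
  note \<alpha>H = pullback_action_Hom[OF G p triv_Y triv_u \<pi> eqv_u, folded \<alpha>_def]
  note \<alpha>_el = pullback_action_elements[OF G p triv_Y triv_u \<pi> eqv_u, folded \<alpha>_def]
  note q_eqv = pullback_projection_equivariant[OF G p triv_Y triv_Z \<pi> eqv_f, folded \<psi>_def q_def]
  note \<beta>H = pullback_action_Hom[OF G \<psi>H triv_Z triv_v q_eqv eqv_v, folded \<beta>_def]
  note \<beta>_el = pullback_action_elements[OF G \<psi>H triv_Z triv_v q_eqv eqv_v, folded \<beta>_def]
  note \<theta>U = left_mult_action_Hom[OF G m obj(4)] and \<theta>V = left_mult_action_Hom[OF G m obj(5)]
  obtain \<chi> where \<chi>: "\<chi> \<in> Arr C" "Dom C \<chi> = Prod C G U" "Cod C \<chi> = pb_obj C \<pi> u"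
      "\<chi> \<cdot> \<phi> = Id C (pb_obj C \<pi> u)" "\<phi> \<cdot> \<chi> = Id C (Prod C G U)"
    using \<phi> uH by (auto simp: trivialisation_def is_iso_def Hom_iff)
  have \<phi>H: "\<phi> \<in> Arr C" "Dom C \<phi> = pb_obj C \<pi> u" "Cod C \<phi> = Prod C G U"
    and \<phi>_over: "pr2 C G U \<cdot> \<phi> = Pb2 C \<pi> u"
    and \<phi>_eqv: "equivariant C G (pb_obj C \<pi> u) \<alpha> (Prod C G U) (left_mult_action C G m U) \<phi>"
    using \<phi> uH by (auto simp: trivialisation_def is_iso_def Hom_iff \<alpha>_def)
  have obj': "pb_obj C \<pi> u \<in> Obj C" "pb_obj C \<pi> f \<in> Obj C" "pb_obj C q v \<in> Obj C"
      "Prod C G U \<in> Obj C" "Prod C G V \<in> Obj C"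
    using \<pi>H fH uH vH qH G obj by simp_all
  have \<phi>_el: "\<phi> \<cdot> \<alpha> \<cdot> pair C a c = left_mult_action C G m U \<cdot> pair C a (\<phi> \<cdot> c)"
    if "a \<in> Arr C" "c \<in> Arr C" "Dom C a = Dom C c" "Cod C a = G" "Cod C c = pb_obj C \<pi> u" for a c
    using \<phi>_eqv that equivariant_iff_elements[OF G obj'(1,4) \<alpha>H \<theta>U] by blast
  have \<phi>_over_Cmp: "pr2 C G U \<cdot> (\<phi> \<cdot> h) = Pb2 C \<pi> u \<cdot> h"
    if "h \<in> Arr C" "Cod C h = pb_obj C \<pi> u" for h
    using that G obj \<phi>H \<phi>_over by (simp flip: Cmp_assoc_simp)
  have \<chi>\<phi>: "\<chi> \<cdot> (\<phi> \<cdot> h) = h" if "h \<in> Arr C" "Cod C h = pb_obj C \<pi> u" for h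
    using that \<chi> \<phi>H by (simp flip: Cmp_assoc_simp)
  have \<phi>\<chi>: "\<phi> \<cdot> (\<chi> \<cdot> h) = h" if "h \<in> Arr C" "Cod C h = Prod C G U" for h
    using that \<chi> \<phi>H by (simp flip: Cmp_assoc_simp)
  have \<chi>_over: "Pb2 C \<pi> u \<cdot> (\<chi> \<cdot> h) = pr2 C G U \<cdot> h"
    if "h \<in> Arr C" "Cod C h = Prod C G U" for h
    using that \<chi> \<phi>_over_Cmp[of "\<chi> \<cdot> h"] \<phi>\<chi>[of h] by simp
  have square_Cmp: "u \<cdot> (w \<cdot> h) = f \<cdot> (v \<cdot> h)" if "h \<in> Arr C" "Cod C h = V" for h
    using that square uH wH fH vH by (simp flip: Cmp_assoc_simp)
  note typing = G m obj obj' \<pi>H fH uH vH wH qH \<phi>H \<chi>(1-3)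

  \<comment> \<open>The morphism \<open>((x, z), t) \<mapsto> (x, w t)\<close> from \<open>(P \<times>\<^sub>Y Z) \<times>\<^sub>Z V\<close> to \<open>P \<times>\<^sub>Y U\<close>.\<close>
  define a where "a = pb_pair C \<pi> u (Pb1 C \<pi> f \<cdot> Pb1 C q v) (w \<cdot> Pb2 C q v)"
  have "\<pi> \<cdot> (Pb1 C \<pi> f \<cdot> Pb1 C q v) = f \<cdot> (q \<cdot> Pb1 C q v)"
    using typing by (simp add: Pb_commute_Cmp q_def)
  also have "\<dots> = u \<cdot> (w \<cdot> Pb2 C q v)"
    using typing by (simp add: Pb_commute square_Cmp)
  finally have a_compat: "\<pi> \<cdot> (Pb1 C \<pi> f \<cdot> Pb1 C q v) = u \<cdot> (w \<cdot> Pb2 C q v)" .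
  have aH: "a \<in> Arr C" "Dom C a = pb_obj C q v" "Cod C a = pb_obj C \<pi> u"
    and Pb_a: "Pb1 C \<pi> u \<cdot> a = Pb1 C \<pi> f \<cdot> Pb1 C q v" "Pb2 C \<pi> u \<cdot> a = w \<cdot> Pb2 C q v"
    unfolding a_def using a_compat typing by simp_all
  have Pb_a_Cmp: "Pb1 C \<pi> u \<cdot> (a \<cdot> h) = Pb1 C \<pi> f \<cdot> (Pb1 C q v \<cdot> h)"
      "Pb2 C \<pi> u \<cdot> (a \<cdot> h) = w \<cdot> (Pb2 C q v \<cdot> h)"
    if "h \<in> Arr C" "Cod C h = pb_obj C q v" for h
    unfolding a_def using that a_compat typing by simp_all
  have a_eqv: "a \<cdot> \<beta> \<cdot> pair C b c = \<alpha> \<cdot> pair C b (a \<cdot> c)"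
    if "b \<in> Arr C" "c \<in> Arr C" "Dom C b = Dom C c" "Cod C b = G" "Cod C c = pb_obj C q v" for b c
    by (rule Pb_jointly_monic[of \<pi> u _ "Dom C c"])
      (use that typing aH \<alpha>H \<beta>H \<psi>H in \<open>simp_all add: Hom_iff \<alpha>_el \<beta>_el \<psi>_el Pb_a_Cmp\<close>)

  define \<Phi> where "\<Phi> = pair C (pr1 C G U \<cdot> \<phi> \<cdot> a) (Pb2 C q v)"
  have \<Phi>H: "\<Phi> \<in> Arr C" "Dom C \<Phi> = pb_obj C q v" "Cod C \<Phi> = Prod C G V"
    unfolding \<Phi>_def using typing aH by simp_all
  \<comment> \<open>The inverse in stages: \<open>b\<close> is the \<open>P\<close>-component of \<open>\<phi>\<^sup>-\<^sup>1 (g, w t)\<close>, and \<open>c\<close> pairs it with \<open>v t\<close>.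
     This pair lies in \<open>P \<times>\<^sub>Y Z\<close> because \<open>\<phi>\<close> is a morphism over \<open>U\<close>.\<close>
  define b where "b = Pb1 C \<pi> u \<cdot> \<chi> \<cdot> prod_map C (Id C G) w"
  define c where "c = pb_pair C \<pi> f b (v \<cdot> pr2 C G V)"
  define \<Psi> where "\<Psi> = pb_pair C q v c (pr2 C G V)"
  have w_pr2: "pr2 C G U \<cdot> prod_map C (Id C G) w = w \<cdot> pr2 C G V"
      and w_pr1: "pr1 C G U \<cdot> prod_map C (Id C G) w = pr1 C G V"
    using typing by (simp_all add: prod_map_def)
  have bH: "b \<in> Arr C" "Dom C b = Prod C G V" "Cod C b = P"
    unfolding b_def using typing by simp_all
  have b_compat: "\<pi> \<cdot> b = f \<cdot> (v \<cdot> pr2 C G V)"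
    unfolding b_def using typing by (simp add: Pb_commute_Cmp \<chi>_over w_pr2 square_Cmp)
  have cH: "c \<in> Arr C" "Dom C c = Prod C G V" "Cod C c = pb_obj C \<pi> f"
    and Pb_c: "Pb1 C \<pi> f \<cdot> c = b" "q \<cdot> c = v \<cdot> pr2 C G V"
    unfolding c_def q_def using typing bH b_compat by simp_all
  have \<Psi>H: "\<Psi> \<in> Arr C" "Dom C \<Psi> = Prod C G V" "Cod C \<Psi> = pb_obj C q v"
    and Pb_\<Psi>: "Pb1 C q v \<cdot> \<Psi> = c" "Pb2 C q v \<cdot> \<Psi> = pr2 C G V"
    unfolding \<Psi>_def using typing cH Pb_c by simp_all
  have Pb_\<Psi>_Cmp: "Pb1 C q v \<cdot> (\<Psi> \<cdot> h) = c \<cdot> h" "Pb2 C q v \<cdot> (\<Psi> \<cdot> h) = pr2 C G V \<cdot> h"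
    if "h \<in> Arr C" "Cod C h = Prod C G V" for h
    unfolding \<Psi>_def using that typing cH Pb_c by simp_all

  have "a \<cdot> \<Psi> = \<chi> \<cdot> prod_map C (Id C G) w"
    by (rule Pb_jointly_monic[of \<pi> u _ "Prod C G V"])
      (use typing aH \<Psi>H in \<open>simp_all add: Hom_iff Pb_a_Cmp Pb_\<Psi> Pb_c \<chi>_over w_pr2 b_def\<close>)
  then have \<Phi>\<Psi>: "\<Phi> \<cdot> \<Psi> = Id C (Prod C G V)"
    unfolding \<Phi>_def using typing aH \<Psi>H by (simp add: Pb_\<Psi> \<phi>\<chi> w_pr1)

  \<comment> \<open>Being over \<open>U\<close>, \<open>\<phi> \<cdot> a\<close> has second component \<open>w t\<close>, so \<open>\<Phi>\<close> followed by \<open>id \<times> w\<close> recovers it.\<close>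
  have w\<Phi>: "prod_map C (Id C G) w \<cdot> \<Phi> = \<phi> \<cdot> a"
    by (rule pr_jointly_monic[of G U _ "pb_obj C q v"])
      (use typing aH in \<open>simp_all add: \<Phi>_def Hom_iff \<phi>_over_Cmp Pb_a\<close>)
  have pr2_\<Phi>: "pr2 C G V \<cdot> \<Phi> = Pb2 C q v"
    unfolding \<Phi>_def using typing aH by simp
  have "c \<cdot> \<Phi> = Pb1 C q v"
  proof (rule Pb_jointly_monic[of \<pi> f _ "pb_obj C q v"])
    have "Pb1 C \<pi> f \<cdot> (c \<cdot> \<Phi>) = b \<cdot> \<Phi>"
      using typing cH \<Phi>H Pb_c by (simp flip: Cmp_assoc_simp)
    also have "\<dots> = Pb1 C \<pi> f \<cdot> Pb1 C q v"
      unfolding b_def using typing aH \<Phi>H by (simp add: w\<Phi> \<chi>\<phi> Pb_a)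
    finally show "Pb1 C \<pi> f \<cdot> (c \<cdot> \<Phi>) = Pb1 C \<pi> f \<cdot> Pb1 C q v" .
    have "q \<cdot> (c \<cdot> \<Phi>) = (v \<cdot> pr2 C G V) \<cdot> \<Phi>"
      using typing cH \<Phi>H Pb_c by (simp flip: Cmp_assoc_simp)
    also have "\<dots> = q \<cdot> Pb1 C q v"
      using typing \<Phi>H by (simp add: pr2_\<Phi> Pb_commute)
    finally show "Pb2 C \<pi> f \<cdot> (c \<cdot> \<Phi>) = Pb2 C \<pi> f \<cdot> Pb1 C q v"
      by (simp add: q_def)
  qed (use typing cH \<Phi>H in \<open>simp_all add: Hom_iff\<close>)
  then have \<Psi>\<Phi>: "\<Psi> \<cdot> \<Phi> = Id C (pb_obj C q v)"
    using typing \<Psi>H \<Phi>H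
    by - (rule Pb_jointly_monic[of q v _ "pb_obj C q v"]; simp add: Hom_iff Pb_\<Psi>_Cmp pr2_\<Phi>)

  have "equivariant C G (pb_obj C q v) \<beta> (Prod C G V) (left_mult_action C G m V) \<Phi>"
    unfolding equivariant_iff_elements[OF G obj'(3,5) \<beta>H \<theta>V]
  proof (intro conjI allI impI)
    fix k x
    assume kx: "k \<in> Arr C" "x \<in> Arr C" "Dom C k = Dom C x" "Cod C k = G" "Cod C x = pb_obj C q v"
    have "\<Phi> \<cdot> \<beta> \<cdot> pair C k x = pair C (m \<cdot> pair C k (pr1 C G U \<cdot> \<phi> \<cdot> a \<cdot> x)) (Pb2 C q v \<cdot> x)"
      unfolding \<Phi>_def using typing aH kx \<beta>H
      by (simp add: Hom_iff a_eqv \<phi>_el left_mult_action_pair \<beta>_el)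
    also have "\<dots> = left_mult_action C G m V \<cdot> pair C k (\<Phi> \<cdot> x)"
      unfolding \<Phi>_def using typing aH kx by (simp add: left_mult_action_pair Hom_iff)
    finally show "\<Phi> \<cdot> \<beta> \<cdot> pair C k x = left_mult_action C G m V \<cdot> pair C k (\<Phi> \<cdot> x)" .
  qed (use \<Phi>H in \<open>simp add: Hom_iff\<close>)
  moreover have "is_iso C (pb_obj C q v) (Prod C G V) \<Phi>"
    unfolding is_iso_def using \<Phi>H \<Psi>H \<Phi>\<Psi> \<Psi>\<Phi> by (auto simp: Hom_iff)
  ultimately have "trivialisation G m \<psi> q v \<Phi>"
    using pr2_\<Phi> vH by (simp add: trivialisation_def \<beta>_def)
  then show ?thesis
    unfolding \<psi>_def q_def ..
qed

end


section \<open>Base change of principal bundles\<close>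

lemma (in grothendieck_topology) locally_trivial_base_change:
  assumes G: "G \<in> Obj C" and m: "m \<in> Hom C (Prod C G G) G"
    and p: "p \<in> Hom C (Prod C G P) P"
    and \<pi>: "equivariant C G P p Y (trivial_action C G Y) \<pi>"
    and triv: "locally_trivial C Cov G m Y p \<pi>"
    and f: "f \<in> Hom C Z Y"
  shows "locally_trivial C Cov G m Z (pullback_action C G \<pi> f p (trivial_action C G Z)) (Pb2 C \<pi> f)"
proof -
  have fH: "f \<in> Arr C" "Dom C f = Z" "Cod C f = Y"
    using f by (simp_all add: Hom_iff)
  then have Y: "Y \<in> Obj C"
    using Cod_Obj by auto
  obtain R where R: "R \<in> Cov Y" and R_triv: "\<forall>u\<in>R. \<exists>\<phi>. trivialisation G m p \<pi> u \<phi>"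
    using triv by (auto simp: locally_trivial_iff_trivialisation)
  have uH: "u \<in> Arr C" "Cod C u = Y" if "u \<in> R" for u
    using Cov_arrows[OF Y R that] by simp_all
  have "(\<lambda>u. Pb2 C u f) ` R \<in> Cov Z"
    using fH uH by (intro Cov_base_change[OF f R, of "\<lambda>u. Pb1 C u f"] Pb_pullback) simp_all
  moreover have "\<exists>\<Phi>. trivialisation G m (pullback_action C G \<pi> f p (trivial_action C G Z))
      (Pb2 C \<pi> f) (Pb2 C u f) \<Phi>" if "u \<in> R" for u
  proof -
    obtain \<phi> where \<phi>: "trivialisation G m p \<pi> u \<phi>"
      using R_triv \<open>u \<in> R\<close> by blast
    have u: "u \<in> Hom C (Dom C u) Y"
      and v: "Pb2 C u f \<in> Hom C (pb_obj C u f) Z"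
      and w: "Pb1 C u f \<in> Hom C (pb_obj C u f) (Dom C u)"
      using uH[OF \<open>u \<in> R\<close>] fH by (simp_all add: Hom_iff)
    have square: "u \<cdot> Pb1 C u f = f \<cdot> Pb2 C u f"
      using uH[OF \<open>u \<in> R\<close>] fH by (intro Pb_commute) simp_all
    show ?thesis
      by (rule trivialisation_base_change[OF G m p \<pi> f u \<phi> v w square])
  qed
  ultimately show ?thesis
    unfolding locally_trivial_iff_trivialisation
    by (intro bexI[of _ "(\<lambda>u. Pb2 C u f) ` R"] ballI) (elim imageE, simp)
qed

theorem proposition3p3:
  fixes C :: "('o, 'm, 'z) pb_category_scheme"
    and Cov :: "'o \<Rightarrow> 'm set set"
    and G Y P Z :: 'o
    and m e p \<pi> f :: 'm
  assumes "grothendieck_topology C Cov"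
    and "group_object C G m e"
    and "principal_bundle C Cov G m e Y P p \<pi>"
    and "f \<in> Hom C Z Y"
  shows "principal_bundle C Cov G m e Z (pb_obj C \<pi> f)
           (pullback_action C G \<pi> f p (trivial_action C G Z)) (Pb2 C \<pi> f)"
proof -
  interpret grothendieck_topology C Cov
    by (rule assms)
  have G: "G \<in> Obj C" and m: "m \<in> Hom C (Prod C G G) G" and e: "e \<in> Hom C (Trm C) G"
    using assms(2) by (simp_all add: group_object_def)
  have Y: "Y \<in> Obj C" and p: "is_action C G m e P p"
    and \<pi>: "equivariant C G P p Y (trivial_action C G Y) \<pi>"
    and triv: "locally_trivial C Cov G m Y p \<pi>"
    using assms(3) by (simp_all add: principal_bundle_def)
  have Z: "Z \<in> Obj C"
    using assms(4) Dom_Obj by (auto simp: Hom_iff)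
  have pH: "p \<in> Hom C (Prod C G P) P"
    using p by (simp add: is_action_def)
  note triv_Y = trivial_action_Hom[OF G Y] and triv_Z = trivial_action_Hom[OF G Z]
  note eqv_f = equivariant_trivial_action[OF G assms(4)]
  have "is_action C G m e (pb_obj C \<pi> f) (pullback_action C G \<pi> f p (trivial_action C G Z))"
    using pullback_action_is_action[OF G m e p trivial_action_is_action[OF G m e Z] triv_Y \<pi> eqv_f] .
  moreover have "equivariant C G (pb_obj C \<pi> f) (pullback_action C G \<pi> f p (trivial_action C G Z))
      Z (trivial_action C G Z) (Pb2 C \<pi> f)"
    by (rule pullback_projection_equivariant[OF G pH triv_Y triv_Z \<pi> eqv_f])
  ultimately show ?thesis
    using Z locally_trivial_base_change[OF G m pH \<pi> triv assms(4)] by (simp add: principal_bundle_def)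
qed

end
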